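(* Not all equi-$n$-squares that are associative Cayley tables are Latin squares. That is, there exist a positive integer $n$ and an associative binary operation on $\{1,\dots,n\}$ whose Cayley table is an equi-$n$-square but is not a Latin square.
   Context: An equi-$n$-square is an $n\times n$ array with entries in $\{1,\dots,n\}$ in which each symbol $1,\dots,n$ occurs exactly $n$ times in the whole array. A Latin square of order $n$ is such an array in which each symbol occurs exactly once in each row and each column. *)

theory Defs
  imports Main "HOL-Library.FuncSet"
begin

text \<open>An \<open>n \<times> n\<close> array is a function on cells \<open>(row, column)\<close>; only its values on
  \<open>{1..n} \<times> {1..n}\<close> matter.\<close>

type_synonym array = "nat \<times> nat \<Rightarrow> nat"

definition square_array :: "nat \<Rightarrow> array \<Rightarrow> bool" where
  "square_array n A \<longleftrightarrow> A \<in> {1..n} \<times> {1..n} \<rightarrow> {1..n}"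

definition equi_square :: "nat \<Rightarrow> array \<Rightarrow> bool" where
  "equi_square n A \<longleftrightarrow> square_array n A \<and>
     (\<forall>s\<in>{1..n}. card {c \<in> {1..n} \<times> {1..n}. A c = s} = n)"

definition latin_square :: "nat \<Rightarrow> array \<Rightarrow> bool" where
  "latin_square n A \<longleftrightarrow> square_array n A \<and>
     (\<forall>i\<in>{1..n}. \<forall>s\<in>{1..n}. \<exists>!j. j \<in> {1..n} \<and> A (i, j) = s) \<and>
     (\<forall>j\<in>{1..n}. \<forall>s\<in>{1..n}. \<exists>!i. i \<in> {1..n} \<and> A (i, j) = s)"

definition binary_operation_on :: "'a set \<Rightarrow> ('a \<Rightarrow> 'a \<Rightarrow> 'a) \<Rightarrow> bool" where
  "binary_operation_on S f \<longleftrightarrow> (\<forall>x\<in>S. \<forall>y\<in>S. f x y \<in> S)"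

definition associative_on :: "'a set \<Rightarrow> ('a \<Rightarrow> 'a \<Rightarrow> 'a) \<Rightarrow> bool" where
  "associative_on S f \<longleftrightarrow> (\<forall>x\<in>S. \<forall>y\<in>S. \<forall>z\<in>S. f (f x y) z = f x (f y z))"

definition cayley_table :: "(nat \<Rightarrow> nat \<Rightarrow> nat) \<Rightarrow> array" where
  "cayley_table f = (\<lambda>(i, j). f i j)"

end

theory Submission imports Defs begin

text \<open>The left projection \<open>x * y = x\<close> is associative, since either bracketing
  returns the leftmost factor. Row \<open>i\<close> of its table is constantly \<open>i\<close>, so
  each symbol fills exactly one row and occurs \<open>n\<close> times, while for
  \<open>n \<ge> 2\<close> a constant row cannot contain every symbol.\<close>

lemma equi_square_left_projection: "equi_square n (cayley_table (\<lambda>x y. x))"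
proof -
  have "{c \<in> {1..n} \<times> {1..n}. cayley_table (\<lambda>x y. x) c = s} = {s} \<times> {1..n}"
    if "s \<in> {1..n}" for s
    using that by (auto simp: cayley_table_def)
  then show ?thesis
    by (auto simp: equi_square_def square_array_def cayley_table_def card_cartesian_product)
qed

lemma not_latin_square_left_projection:
  assumes "n \<ge> 2"
  shows "\<not> latin_square n (cayley_table (\<lambda>x y. x))"
proof
  assume "latin_square n (cayley_table (\<lambda>x y. x))"
  moreover have "1 \<in> {1..n}" "2 \<in> {1..n}"
    using assms by auto
  \<comment> \<open>Existence already fails: row 1 holds only the symbol 1.\<close>
  ultimately have "\<exists>!j. j \<in> {1..n} \<and> cayley_table (\<lambda>x y. x) (1, j) = 2"
    unfolding latin_square_def by blast
  then show False
    by (auto simp: cayley_table_def)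
qed

theorem corollary1p4p1:
  "\<exists>(n::nat) (f :: nat \<Rightarrow> nat \<Rightarrow> nat).
     n > 0 \<and> binary_operation_on {1..n} f \<and> associative_on {1..n} f \<and>
     equi_square n (cayley_table f) \<and> \<not> latin_square n (cayley_table f)"
proof (intro exI conjI)
  \<comment> \<open>This goal instantiates the schematic witnesses. The order 2 is least possible,
    as the only table of order 1 is Latin.\<close>
  show "binary_operation_on {1..2} (\<lambda>x y :: nat. x)"
    by (simp add: binary_operation_on_def)
  show "associative_on {1..2} (\<lambda>x y :: nat. x)"
    by (simp add: associative_on_def)
qed (simp_all add: equi_square_left_projection not_latin_square_left_projection)

end
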